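(* Let $H$ be a separable complex Hilbert space and let $A$ be a (bounded or unbounded) self-adjoint operator in $H$ with domain $D(A)$ whose spectrum consists of simple eigenvalues $\lambda_j$, $j\in\mathbb{Z}$, with $\lambda_j<\lambda_{j+1}$ for all $j\in\mathbb{Z}$. Let $\{e_j\}_{j\in\mathbb{Z}}$ be the corresponding orthonormal basis of eigenvectors, $Ae_j=\lambda_j e_j$. Let $f\in C^\infty(A)=\bigcap_{m\ge 1}D(A^m)$. Then $f$ is a cyclic vector for $A$ if and only if for each integer $k$ the following two conditions hold: $1^\circ$. $(f,e_k)\neq 0$; $2^\circ$. $\displaystyle\lim_{n\to\infty}\big\langle (E_{2n+1}+K_{2n+1})^{-1}e_{2n+1}^{(k)},\,e_{2n+1}^{(k)}\big\rangle=1$, where the matrices $E_{2n+1}$, $K_{2n+1}$ (the latter being well defined once $1^\circ$ holds for all integers) and the vectors $e_{2n+1}^{(k)}$ ($|k|<n$) are those defined in the context.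
   Context: $(\cdot,\cdot)$ is the inner product of $H$, linear in the first argument. A vector $f\in C^\infty(A)$ is called a cyclic vector for $A$ if the closed linear span of $f,Af,A^2f,\dots$ is all of $H$. For a natural number $n$ put $P_{2n+1}(\lambda)=\prod_{i=-n}^{n}(\lambda-\lambda_i)$ and $\dot P_{2n+1}(\lambda)=\frac{d}{d\lambda}P_{2n+1}(\lambda)$. $\langle\cdot,\cdot\rangle$ is the standard inner product of $\mathbb{C}^{2n+1}$, whose coordinates are indexed by $-n,-n+1,\dots,n$. $E_{2n+1}$ is the identity matrix of order $2n+1$. $K_{2n+1}$ is the Hermitian matrix of order $2n+1$ with entries, for $i,j=-n,\dots,n$, $$k_{ij}^{(n)}=\frac{1}{(f,e_i)\overline{(f,e_j)}}\cdot\frac{1}{\dot P_{2n+1}(\lambda_i)\dot P_{2n+1}(\lambda_j)}\sum_{|s|>n}\frac{P_{2n+1}^2(\lambda_s)\,|(f,e_s)|^2}{(\lambda_s-\lambda_i)(\lambda_s-\lambda_j)},$$ where the sum is over all integers $s$ with $|s|>n$. For $|k|<n$, $e_{2n+1}^{(k)}\in\mathbb{C}^{2n+1}$ is the column vector with components $\delta_{ik}$ (Kronecker delta), $i=-n,\dots,n$. *)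

theory Defs
  imports
    "HOL-Analysis.Derivative"
    "HOL-Analysis.Infinite_Sum"
    "HOL-Analysis.Abstract_Topological_Spaces"
    "Jordan_Normal_Form.Gauss_Jordan_Elimination"
begin

section \<open>Complex Hilbert spaces\<close>

text \<open>The inner product is linear in the first and conjugate-linear in the second argument;
  the norm and the metric topology are those inherited from \<^class>\<open>real_normed_vector\<close>,
  tied to the inner product by the last axiom.\<close>

class complex_inner = real_normed_vector +
  fixes scaleC :: "complex \<Rightarrow> 'a \<Rightarrow> 'a" (infixr \<open>*\<^sub>C\<close> 75)
    and cinner :: "'a \<Rightarrow> 'a \<Rightarrow> complex"
  assumes scaleC_add_right: "a *\<^sub>C (x + y) = a *\<^sub>C x + a *\<^sub>C y"
    and scaleC_add_left: "(a + b) *\<^sub>C x = a *\<^sub>C x + b *\<^sub>C x"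
    and scaleC_scaleC: "a *\<^sub>C b *\<^sub>C x = (a * b) *\<^sub>C x"
    and scaleC_of_real: "complex_of_real r *\<^sub>C x = r *\<^sub>R x"
    and cinner_commute: "cinner x y = cnj (cinner y x)"
    and cinner_add_left: "cinner (x + y) z = cinner x z + cinner y z"
    and cinner_scaleC_left: "cinner (a *\<^sub>C x) y = a * cinner x y"
    and cinner_self: "cinner x x = complex_of_real ((norm x)\<^sup>2)"

class complex_hilbert = complex_inner + complete_space

lemma scaleC_one: "1 *\<^sub>C (x :: 'a::complex_inner) = x"
  using scaleC_of_real[of 1 x] by simp

global_interpretation complex_vector: vector_space "scaleC :: complex \<Rightarrow> 'a \<Rightarrow> 'a::complex_inner"
  defines csubspace = complex_vector.subspace
    and cspan = complex_vector.span
    and cdim = complex_vector.dim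
  by unfold_locales (rule scaleC_add_right scaleC_add_left scaleC_scaleC scaleC_one)+

definition orthonormal_basis :: "('i \<Rightarrow> 'a::complex_hilbert) \<Rightarrow> bool" where
  "orthonormal_basis e \<longleftrightarrow>
     (\<forall>i j. cinner (e i) (e j) = (if i = j then 1 else 0)) \<and> closure (cspan (range e)) = UNIV"

section \<open>Unbounded operators\<close>

text \<open>An operator is given by its domain \<open>D\<close> and a function \<open>A\<close> of which only the values
  on \<open>D\<close> matter.\<close>

definition linear_operator :: "'a::complex_hilbert set \<Rightarrow> ('a \<Rightarrow> 'a) \<Rightarrow> bool" where
  "linear_operator D A \<longleftrightarrow> csubspace D \<and>
     (\<forall>x\<in>D. \<forall>y\<in>D. A (x + y) = A x + A y) \<and> (\<forall>c. \<forall>x\<in>D. A (c *\<^sub>C x) = c *\<^sub>C A x)"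

definition adjoint_domain :: "'a::complex_hilbert set \<Rightarrow> ('a \<Rightarrow> 'a) \<Rightarrow> 'a set" where
  "adjoint_domain D A = {y. \<exists>z. \<forall>x\<in>D. cinner (A x) y = cinner x z}"

text \<open>The value is unique on \<^term>\<open>adjoint_domain D A\<close> when \<open>D\<close> is dense.\<close>

definition adjoint_operator :: "'a::complex_hilbert set \<Rightarrow> ('a \<Rightarrow> 'a) \<Rightarrow> 'a \<Rightarrow> 'a" where
  "adjoint_operator D A y = (THE z. \<forall>x\<in>D. cinner (A x) y = cinner x z)"

definition self_adjoint :: "'a::complex_hilbert set \<Rightarrow> ('a \<Rightarrow> 'a) \<Rightarrow> bool" where
  "self_adjoint D A \<longleftrightarrow> linear_operator D A \<and> closure D = UNIV \<and>
     adjoint_domain D A = D \<and> (\<forall>y\<in>D. adjoint_operator D A y = A y)"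

definition resolvent_set :: "'a::complex_hilbert set \<Rightarrow> ('a \<Rightarrow> 'a) \<Rightarrow> complex set" where
  "resolvent_set D A = {z. bij_betw (\<lambda>x. A x - z *\<^sub>C x) D UNIV \<and>
     (\<exists>C. \<forall>x\<in>D. norm x \<le> C * norm (A x - z *\<^sub>C x))}"

definition spectrum :: "'a::complex_hilbert set \<Rightarrow> ('a \<Rightarrow> 'a) \<Rightarrow> complex set" where
  "spectrum D A = - resolvent_set D A"

definition eigenspace :: "'a::complex_hilbert set \<Rightarrow> ('a \<Rightarrow> 'a) \<Rightarrow> complex \<Rightarrow> 'a set" where
  "eigenspace D A z = {x \<in> D. A x = z *\<^sub>C x}"

definition point_spectrum :: "'a::complex_hilbert set \<Rightarrow> ('a \<Rightarrow> 'a) \<Rightarrow> complex set" where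
  "point_spectrum D A = {z. \<exists>x \<in> eigenspace D A z. x \<noteq> 0}"

text \<open>The spectrum consists of the simple eigenvalues \<open>lam j\<close>. It is required to be the closure of
  the set of eigenvalues, not that set itself: for a bounded operator the strictly increasing
  two-sided sequence \<open>lam\<close> has limit points, which lie in the spectrum without being eigenvalues.
  When \<open>lam\<close> is unbounded in both directions the set of eigenvalues is already closed.\<close>

definition simple_point_spectrum ::
    "'a::complex_hilbert set \<Rightarrow> ('a \<Rightarrow> 'a) \<Rightarrow> (int \<Rightarrow> real) \<Rightarrow> bool" where
  "simple_point_spectrum D A lam \<longleftrightarrow>
     point_spectrum D A = range (\<lambda>j. complex_of_real (lam j)) \<and>
     spectrum D A = closure (point_spectrum D A) \<and>
     (\<forall>z \<in> point_spectrum D A. cdim (eigenspace D A z) = 1)"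

primrec power_domain :: "'a::complex_hilbert set \<Rightarrow> ('a \<Rightarrow> 'a) \<Rightarrow> nat \<Rightarrow> 'a set" where
  "power_domain D A 0 = UNIV"
| "power_domain D A (Suc m) = {x \<in> power_domain D A m. (A ^^ m) x \<in> D}"

definition C_infinity :: "'a::complex_hilbert set \<Rightarrow> ('a \<Rightarrow> 'a) \<Rightarrow> 'a set" where
  "C_infinity D A = (\<Inter>m\<in>{1..}. power_domain D A m)"

definition cyclic_vector :: "'a::complex_hilbert set \<Rightarrow> ('a \<Rightarrow> 'a) \<Rightarrow> 'a \<Rightarrow> bool" where
  "cyclic_vector D A f \<longleftrightarrow>
     f \<in> C_infinity D A \<and> closure (cspan (range (\<lambda>m. (A ^^ m) f))) = UNIV"

section \<open>The matrices of order \<open>2n + 1\<close>\<close>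

definition P_poly :: "(int \<Rightarrow> real) \<Rightarrow> nat \<Rightarrow> real \<Rightarrow> real" where
  "P_poly lam n x = (\<Prod>i\<in>{- int n..int n}. x - lam i)"

definition K_entry :: "(int \<Rightarrow> real) \<Rightarrow> (int \<Rightarrow> 'a::complex_hilbert) \<Rightarrow> 'a \<Rightarrow> nat \<Rightarrow> int \<Rightarrow> int \<Rightarrow> complex" where
  "K_entry lam e f n i j =
     1 / (cinner f (e i) * cnj (cinner f (e j))) *
     complex_of_real (1 / (deriv (P_poly lam n) (lam i) * deriv (P_poly lam n) (lam j)) *
       (\<Sum>\<^sub>\<infinity>s\<in>{s. \<bar>s\<bar> > int n}. (P_poly lam n (lam s))\<^sup>2 * (cmod (cinner f (e s)))\<^sup>2 /
          ((lam s - lam i) * (lam s - lam j))))"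

text \<open>Matrices and vectors of the library are indexed by \<open>0, \<dots>, 2n\<close>; position \<open>a\<close> stands for the
  index \<open>a - n\<close> in \<open>-n, \<dots>, n\<close>.\<close>

definition K_matrix :: "(int \<Rightarrow> real) \<Rightarrow> (int \<Rightarrow> 'a::complex_hilbert) \<Rightarrow> 'a \<Rightarrow> nat \<Rightarrow> complex mat" where
  "K_matrix lam e f n = mat (2 * n + 1) (2 * n + 1)
     (\<lambda>(a, b). K_entry lam e f n (int a - int n) (int b - int n))"

definition delta_vec :: "nat \<Rightarrow> int \<Rightarrow> complex vec" where
  "delta_vec n k = vec (2 * n + 1) (\<lambda>a. if int a - int n = k then 1 else 0)"

end

theory Submission
  imports Defs "Jordan_Normal_Form.Determinant"
begin

text \<open>Let \<open>q\<^sub>i(x) = P(x) / (x - \<lambda>\<^sub>i)\<close> with \<open>P = P\<^bsub>2n+1\<^esub>\<close>. By Parseval's identity \<open>E + K\<close> is the Gram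
  matrix of the vectors \<open>q\<^sub>i(A) f / ((f, e\<^sub>i) q\<^sub>i(\<lambda>\<^sub>i))\<close>, whose coordinates of index at most \<open>n\<close> in
  absolute value are Kronecker deltas and which, by Lagrange interpolation, span the same subspace as
  \<open>f, A f, \<dots>, A\<^sup>2\<^sup>n f\<close>. Hence the \<open>k\<close>-th diagonal entry of \<open>(E + K)\<close> inverted is \<open>1 - d\<^sup>2\<close> for the
  distance \<open>d\<close> from \<open>e\<^sub>k\<close> to that subspace. It tends to 1 iff \<open>e\<^sub>k\<close> lies in the closed span of all
  \<open>A\<^sup>m f\<close>, and \<open>f\<close> is cyclic iff this holds for every \<open>k\<close>.\<close>

section \<open>Inner products and orthonormal expansions\<close>

lemma additive_cinner_left: "additive (\<lambda>x :: 'a::complex_inner. cinner x z)"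
  by (rule additive.intro) (rule cinner_add_left)

lemmas cinner_zero_left = additive.zero[OF additive_cinner_left]
  and cinner_diff_left = additive.diff[OF additive_cinner_left]
  and cinner_sum_left = additive.sum[OF additive_cinner_left]

lemma cinner_add_right: "cinner x (y + z) = cinner x y + cinner (x :: 'a::complex_inner) z"
  by (metis cinner_add_left cinner_commute complex_cnj_add)

lemma additive_cinner_right: "additive (cinner (x :: 'a::complex_inner))"
  by (rule additive.intro) (rule cinner_add_right)

lemmas cinner_zero_right = additive.zero[OF additive_cinner_right]
  and cinner_diff_right = additive.diff[OF additive_cinner_right]
  and cinner_sum_right = additive.sum[OF additive_cinner_right]

lemma cinner_scaleC_right: "cinner x (a *\<^sub>C y) = cnj a * cinner (x :: 'a::complex_inner) y"
  by (metis cinner_commute cinner_scaleC_left complex_cnj_mult)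

lemma cinner_eq_0_commute: "cinner x y = 0 \<longleftrightarrow> cinner y (x :: 'a::complex_inner) = 0"
  by (metis cinner_commute complex_cnj_zero)

lemma norm_add_orthogonal:
  fixes x y :: "'a::complex_inner"
  assumes "cinner x y = 0"
  shows "(norm (x + y))\<^sup>2 = (norm x)\<^sup>2 + (norm y)\<^sup>2"
proof -
  have "complex_of_real ((norm (x + y))\<^sup>2) = complex_of_real ((norm x)\<^sup>2 + (norm y)\<^sup>2)"
    using assms cinner_eq_0_commute[of x y]
    by (simp only: cinner_self[symmetric] of_real_add cinner_add_left cinner_add_right) simp
  then show ?thesis by (simp only: of_real_eq_iff)
qed

lemma norm_scaleC: "norm (a *\<^sub>C x) = cmod a * norm (x :: 'a::complex_inner)"
proof -
  have "complex_of_real ((norm (a *\<^sub>C x))\<^sup>2) = complex_of_real ((cmod a * norm x)\<^sup>2)"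
    using complex_norm_square[of a]
    by (simp only: cinner_self[symmetric] cinner_scaleC_left cinner_scaleC_right)
      (simp add: cinner_self power_mult_distrib)
  then show ?thesis by (simp only: of_real_eq_iff) simp
qed

lemma cinner_Cauchy_Schwarz: "cmod (cinner x y) \<le> norm x * norm (y :: 'a::complex_inner)"
proof (cases "y = 0")
  case True
  then show ?thesis by (simp add: cinner_zero_right)
next
  case False
  \<comment> \<open>\<open>p\<close> is the orthogonal projection of \<open>x\<close> onto the line
    through \<open>y\<close>. Its norm is \<open>cmod (cinner x y) / norm y\<close>, and by
    Pythagoras it is at most \<open>norm x\<close>.\<close>
  define p where "p = (cinner x y / cinner y y) *\<^sub>C y"
  have yy: "cinner y y \<noteq> 0" using False by (simp add: cinner_self)
  have "cinner (x - p) y = 0"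
    using yy by (simp add: p_def cinner_diff_left cinner_scaleC_left)
  then have "cinner p (x - p) = 0"
    using cinner_eq_0_commute by (metis cinner_scaleC_left mult_zero_right p_def)
  from norm_add_orthogonal[OF this] have "(norm p)\<^sup>2 \<le> (norm x)\<^sup>2" by simp
  then have "norm p \<le> norm x" by (rule power2_le_imp_le) simp
  moreover have "norm p = cmod (cinner x y) / norm y"
    using False by (simp add: p_def norm_scaleC norm_divide cinner_self power2_eq_square norm_mult)
  ultimately show ?thesis using False by (simp add: field_simps)
qed

lemma bounded_linear_cinner_left: "bounded_linear (\<lambda>x :: 'a::complex_inner. cinner x z)"
proof (rule bounded_linear_intro)
  show "cinner (r *\<^sub>R x) z = r *\<^sub>R cinner x z" for r and x :: 'a
    by (simp add: scaleC_of_real[symmetric] cinner_scaleC_left scaleR_conv_of_real)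
qed (rule cinner_add_left, rule cinner_Cauchy_Schwarz)

text \<open>For nonzero \<open>w\<close>, density puts a point \<open>x\<close> of \<open>D\<close>
  closer to \<open>w\<close> than 0 is. Pythagoras contradicts this, since moving from 0 to an
  orthogonal \<open>x\<close> cannot decrease the distance to \<open>w\<close>.\<close>

lemma eq_0_if_orthogonal_to_dense:
  fixes w :: "'a::complex_inner"
  assumes "closure D = UNIV" and "\<And>x. x \<in> D \<Longrightarrow> cinner x w = 0"
  shows "w = 0"
proof (rule ccontr)
  assume "w \<noteq> 0"
  then obtain x where x: "x \<in> D" "dist x w < norm w"
    using closure_approachable[of w D] assms(1) by (metis UNIV_I zero_less_norm_iff)
  have "cinner w (- x) = 0"
    using assms(2)[OF x(1)] cinner_eq_0_commute[of w x] cinner_diff_right[of w 0 x]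
    by (simp add: cinner_zero_right)
  then have "(norm (w - x))\<^sup>2 = (norm w)\<^sup>2 + (norm x)\<^sup>2"
    using norm_add_orthogonal[of w "- x"] by simp
  then have "(norm w)\<^sup>2 \<le> (norm (w - x))\<^sup>2" by simp
  then have "norm w \<le> norm (w - x)" by (rule power2_le_imp_le) simp
  with x(2) show False by (simp add: dist_norm norm_minus_commute)
qed

lemma cinner_cspan_eq_0:
  assumes "w \<in> cspan B" and "\<And>b. b \<in> B \<Longrightarrow> cinner b h = 0"
  shows "cinner w h = 0"
  using assms(1)
proof (induction rule: complex_vector.span_induct)
  case base
  show ?case
    unfolding complex_vector.subspace_def
    by (simp add: cinner_zero_left cinner_add_left cinner_scaleC_left)
qed (rule assms(2))

text \<open>Split \<open>g - y\<close> into \<open>g - v\<close> and \<open>v - y\<close>; the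
  second lies in the span, hence is orthogonal to the first, and Pythagoras applies.\<close>

lemma orthogonal_projection_nearest:
  fixes g :: "'a::complex_inner"
  assumes "v \<in> cspan B" and "y \<in> cspan B" and "\<And>w. w \<in> B \<Longrightarrow> cinner w (g - v) = 0"
  shows "norm (g - v) \<le> norm (g - y)"
proof -
  have "cinner (v - y) (g - v) = 0"
    by (rule cinner_cspan_eq_0[OF complex_vector.span_diff[OF assms(1,2)] assms(3)])
  from norm_add_orthogonal[OF this] have "(norm (g - v))\<^sup>2 \<le> (norm (g - y))\<^sup>2" by simp
  then show ?thesis by (rule power2_le_imp_le) simp
qed

section \<open>Closed subspaces, orthonormal expansions and Parseval's identity\<close>

lemma closure_csubspace:
  fixes S :: "'a::complex_inner set"
  assumes "csubspace S"
  shows "csubspace (closure S)"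
proof -
  have add: "x + y \<in> closure S" if "x \<in> closure S" "y \<in> closure S" for x y
  proof -
    obtain X Y where "\<forall>n. X n \<in> S" "X \<longlonglongrightarrow> x" "\<forall>n. Y n \<in> S" "Y \<longlonglongrightarrow> y"
      using \<open>x \<in> closure S\<close> \<open>y \<in> closure S\<close> by (auto simp: closure_sequential)
    then have "\<forall>n. X n + Y n \<in> S" "(\<lambda>n. X n + Y n) \<longlonglongrightarrow> x + y"
      using complex_vector.subspace_add[OF assms] by (auto intro: tendsto_add)
    then show ?thesis by (auto simp: closure_sequential)
  qed
  have scale: "c *\<^sub>C x \<in> closure S" if x: "x \<in> closure S" for c x
  proof -
    obtain X where X: "\<forall>n. X n \<in> S" "X \<longlonglongrightarrow> x" using x by (auto simp: closure_sequential)
    have "bounded_linear (\<lambda>x :: 'a. c *\<^sub>C x)"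
    proof (rule bounded_linear_intro)
      show "c *\<^sub>C (r *\<^sub>R x) = r *\<^sub>R (c *\<^sub>C x)" for r and x :: 'a
        by (simp add: scaleC_of_real[symmetric] scaleC_scaleC mult.commute)
      show "norm (c *\<^sub>C x) \<le> norm x * cmod c" for x :: 'a
        by (simp add: norm_scaleC)
    qed (rule scaleC_add_right)
    from bounded_linear.tendsto[OF this X(2)] have "(\<lambda>n. c *\<^sub>C X n) \<longlonglongrightarrow> c *\<^sub>C x" .
    moreover have "\<forall>n. c *\<^sub>C X n \<in> S"
      using X(1) complex_vector.subspace_scale[OF assms] by auto
    ultimately show ?thesis by (auto simp: closure_sequential)
  qed
  have "0 \<in> closure S" using complex_vector.subspace_0[OF assms] closure_subset by blast
  with add scale show ?thesis by (simp add: complex_vector.subspace_def)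
qed

text \<open>This turns an approximation from an infinite span into one from a finite index set, both
  for partial sums of expansions and for the growing spans of the \<open>b m\<close>.\<close>

lemma cspan_subset_eq_finite_image:
  assumes "y \<in> cspan (range e)"
  obtains F where "finite F" and "y \<in> cspan (e ` F)"
proof -
  obtain t r where t: "finite t" "t \<subseteq> range e" "y = (\<Sum>a\<in>t. r a *\<^sub>C a)"
    using assms unfolding complex_vector.span_explicit by auto
  obtain F where "finite F" "t = e ` F" using finite_subset_image[OF t(1,2)] by auto
  moreover have "y \<in> cspan t"
    unfolding t(3) by (intro complex_vector.span_sum complex_vector.span_scale complex_vector.span_base)
  ultimately show ?thesis using that by auto
qed

text \<open>A finite combination \<open>y\<close> of basis vectors approximates \<open>g\<close>.
  Over any finite index set that contains the support of \<open>y\<close>, the partial sum is the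
  projection of \<open>g\<close> and so at least as close as \<open>y\<close>.\<close>

lemma orthonormal_expansion:
  assumes "orthonormal_basis e"
  shows "((\<lambda>s. cinner g (e s) *\<^sub>C e s) has_sum g) UNIV"
  unfolding has_sum_def tendsto_iff eventually_finite_subsets_at_top
proof (intro allI impI)
  fix \<epsilon> :: real
  assume "\<epsilon> > 0"
  then obtain y where y: "y \<in> cspan (range e)" "dist y g < \<epsilon>"
    using assms closure_approachable[of g "cspan (range e)"]
    unfolding orthonormal_basis_def by auto
  obtain F0 where F0: "finite F0" "y \<in> cspan (e ` F0)"
    using cspan_subset_eq_finite_image[OF y(1)] .
  have "dist (\<Sum>s\<in>F. cinner g (e s) *\<^sub>C e s) g < \<epsilon>" if F: "finite F" "F0 \<subseteq> F" for F
  proof -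
    let ?v = "\<Sum>s\<in>F. cinner g (e s) *\<^sub>C e s"
    have "cinner (e s) (g - ?v) = 0" if "s \<in> F" for s
    proof -
      have "cinner (e s) ?v = (\<Sum>t\<in>F. if t = s then cnj (cinner g (e s)) else 0)"
        using assms unfolding cinner_sum_right cinner_scaleC_right orthonormal_basis_def
        by (intro sum.cong) auto
      also have "\<dots> = cinner (e s) g"
        using that F(1) cinner_commute[of "e s" g] by simp
      finally show ?thesis by (simp add: cinner_diff_right)
    qed
    moreover have "?v \<in> cspan (e ` F)"
      by (intro complex_vector.span_sum complex_vector.span_scale complex_vector.span_base) auto
    moreover have "y \<in> cspan (e ` F)"
      using F0(2) complex_vector.span_mono[OF image_mono[OF F(2)]] by auto
    ultimately have "norm (g - ?v) \<le> norm (g - y)"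
      by (intro orthogonal_projection_nearest) auto
    with y(2) show ?thesis by (simp add: dist_norm norm_minus_commute)
  qed
  with F0(1) show "\<exists>X. finite X \<and> X \<subseteq> UNIV \<and> (\<forall>Y. finite Y \<and> X \<subseteq> Y \<and> Y \<subseteq> UNIV \<longrightarrow>
      dist (\<Sum>s\<in>Y. cinner g (e s) *\<^sub>C e s) g < \<epsilon>)"
    by auto
qed

lemma orthonormal_coords_eqI:
  assumes "orthonormal_basis e" and "\<And>s. cinner g (e s) = cinner h (e s)"
  shows "g = h"
  using orthonormal_expansion[OF assms(1), of g] orthonormal_expansion[OF assms(1), of h] assms(2)
  by (simp add: has_sum_unique)

lemma Parseval:
  assumes "orthonormal_basis e"
  shows "((\<lambda>s. cinner g (e s) * cnj (cinner h (e s))) has_sum cinner g h) UNIV"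
proof -
  have "((\<lambda>s. cinner (cinner g (e s) *\<^sub>C e s) h) has_sum cinner g h) UNIV"
    by (rule has_sum_bounded_linear[OF bounded_linear_cinner_left orthonormal_expansion[OF assms],
      unfolded o_def])
  then show ?thesis
    by (simp add: cinner_scaleC_left cinner_commute[symmetric])
qed

text \<open>\<open>K_entry\<close> contains a real \<open>infsum\<close>, whereas Parseval's
  identity yields a complex \<open>has_sum\<close>. Taking real parts supplies the real summability,
  so \<open>infsum\<close> is not its default value 0.\<close>

lemma of_real_infsum_eq:
  assumes "((\<lambda>x. complex_of_real (t x)) has_sum S) X"
  shows "complex_of_real (infsum t X) = S"
proof -
  have t: "(t has_sum Re S) X"
    using has_sum_bounded_linear[OF bounded_linear_Re assms] by (simp add: o_def)
  then have "((\<lambda>x. complex_of_real (t x)) has_sum complex_of_real (Re S)) X"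
    by (rule has_sum_of_real)
  with assms t show ?thesis by (simp add: infsumI has_sum_unique)
qed

section \<open>Self-adjoint operators\<close>

lemma self_adjoint_symmetric:
  assumes "self_adjoint D A" and "x \<in> D" and "y \<in> D"
  shows "cinner (A x) y = cinner x (A y)"
proof -
  have dense: "closure D = UNIV" and y: "y \<in> adjoint_domain D A" "adjoint_operator D A y = A y"
    using assms unfolding self_adjoint_def by auto
  then obtain z where z: "\<forall>x\<in>D. cinner (A x) y = cinner x z"
    unfolding adjoint_domain_def by auto
  \<comment> \<open>\<open>adjoint_operator\<close> is given by a definite description, so
    uniqueness of the representing vector is required; it follows from the density of
    \<open>D\<close>.\<close>
  have "z' = z" if "\<forall>x\<in>D. cinner (A x) y = cinner x z'" for z'
  proof -
    have "z' - z = 0"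
      by (rule eq_0_if_orthogonal_to_dense[OF dense])
        (use that z in \<open>simp add: cinner_diff_right\<close>)
    then show ?thesis by simp
  qed
  with z have "adjoint_operator D A y = z"
    unfolding adjoint_operator_def by (intro the_equality) auto
  with z y(2) assms(2) show ?thesis by simp
qed

text \<open>Symmetry moves the factors \<open>A\<close> onto the eigenvector one at a time;
  conjugation leaves the real eigenvalue unchanged.\<close>

lemma cinner_power_eigenvector:
  assumes "self_adjoint D A" and "f \<in> C_infinity D A"
    and "v \<in> D" and "A v = complex_of_real c *\<^sub>C v"
  shows "cinner ((A ^^ m) f) v = complex_of_real (c ^ m) * cinner f v"
proof (induction m)
  case (Suc m)
  have "f \<in> power_domain D A (Suc m)"
    using assms(2) unfolding C_infinity_def by (rule INT_D) simp
  then have "(A ^^ m) f \<in> D" by simp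
  from self_adjoint_symmetric[OF assms(1) this assms(3)] Suc show ?case
    by (simp add: assms(4) cinner_scaleC_right)
qed simp

section \<open>Lagrange vectors\<close>

text \<open>Only the coordinates of the vectors \<open>b m = A ^ m f\<close> matter, not the operator itself.\<close>

locale moment_sequence =
  fixes e :: "int \<Rightarrow> 'a::complex_hilbert" and lam :: "int \<Rightarrow> real" and f :: 'a and b :: "nat \<Rightarrow> 'a"
  assumes basis: "orthonormal_basis e"
    and inj_lam: "inj lam"
    and coord: "cinner (b m) (e s) = complex_of_real (lam s ^ m) * cinner f (e s)"
    and f_nz: "cinner f (e s) \<noteq> 0"
begin

definition node_poly :: "nat \<Rightarrow> int \<Rightarrow> real poly" where
  "node_poly n i = (\<Prod>j\<in>{- int n..int n} - {i}. [:- lam j, 1:])"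

text \<open>For \<open>b m = (A ^^ m) f\<close> this is the vector p(A) f.\<close>

definition poly_vec :: "real poly \<Rightarrow> 'a" where
  "poly_vec p = (\<Sum>m\<le>degree p. complex_of_real (coeff p m) *\<^sub>C b m)"

definition lag :: "nat \<Rightarrow> int \<Rightarrow> 'a" where
  "lag n i = (1 / (cinner f (e i) * complex_of_real (poly (node_poly n i) (lam i)))) *\<^sub>C
     poly_vec (node_poly n i)"

lemma coord_poly_vec: "cinner (poly_vec p) (e s) = complex_of_real (poly p (lam s)) * cinner f (e s)"
  unfolding poly_vec_def cinner_sum_left cinner_scaleC_left coord
  by (simp add: poly_altdef sum_distrib_right mult.assoc)

lemma poly_node_poly: "poly (node_poly n i) x = (\<Prod>j\<in>{- int n..int n} - {i}. x - lam j)"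
  by (simp add: node_poly_def poly_prod)

lemma node_poly_eq_0:
  assumes "s \<in> {- int n..int n}" and "s \<noteq> i"
  shows "poly (node_poly n i) (lam s) = 0"
  using assms by (auto simp: poly_node_poly)

lemma node_poly_nz: "poly (node_poly n i) (lam i) \<noteq> 0"
  using inj_lam by (auto simp: poly_node_poly inj_eq)

lemma degree_node_poly:
  assumes "i \<in> {- int n..int n}"
  shows "degree (node_poly n i) = 2 * n"
proof -
  have "degree (node_poly n i) = (\<Sum>j\<in>{- int n..int n} - {i}. degree [:- lam j, 1:])"
    unfolding node_poly_def by (rule degree_prod_eq_sum_degree) auto
  also have "\<dots> = 2 * n" using assms by simp
  finally show ?thesis .
qed

lemma P_poly_eq:
  assumes "i \<in> {- int n..int n}"
  shows "P_poly lam n x = (x - lam i) * poly (node_poly n i) x"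
  using assms by (simp add: P_poly_def poly_node_poly prod.remove)

text \<open>By the product rule at the root \<open>lam i\<close>, only the cofactor survives. This
  identifies the derivatives in \<open>K_entry\<close> with the normalising factors of
  \<open>lag\<close>.\<close>

lemma deriv_P_poly:
  assumes "i \<in> {- int n..int n}"
  shows "deriv (P_poly lam n) (lam i) = poly (node_poly n i) (lam i)"
proof (rule DERIV_imp_deriv)
  have "((\<lambda>x. (x - lam i) * poly (node_poly n i) x) has_field_derivative
      poly (node_poly n i) (lam i)) (at (lam i))"
    by (auto intro!: derivative_eq_intros poly_DERIV)
  moreover have "P_poly lam n = (\<lambda>x. (x - lam i) * poly (node_poly n i) x)"
    using P_poly_eq[OF assms] by auto
  ultimately show "(P_poly lam n has_field_derivative poly (node_poly n i) (lam i)) (at (lam i))"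
    by simp
qed

lemma coord_lag:
  "cinner (lag n i) (e s) = complex_of_real (poly (node_poly n i) (lam s)) * cinner f (e s) /
     (cinner f (e i) * complex_of_real (poly (node_poly n i) (lam i)))"
  by (simp add: lag_def cinner_scaleC_left coord_poly_vec)

lemma coord_lag_node:
  assumes "s \<in> {- int n..int n}"
  shows "cinner (lag n i) (e s) = (if s = i then 1 else 0)"
  using node_poly_eq_0[OF assms] node_poly_nz f_nz by (auto simp: coord_lag)

lemma Gram_lag:
  assumes i: "i \<in> {- int n..int n}" and j: "j \<in> {- int n..int n}"
  shows "cinner (lag n i) (lag n j) = (if i = j then 1 else 0) + K_entry lam e f n i j"
proof -
  let ?q = "\<lambda>i s. poly (node_poly n i) (lam s)"
  let ?I = "{- int n..int n}"
  let ?g = "\<lambda>s. cinner (lag n i) (e s) * cnj (cinner (lag n j) (e s))"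
  \<comment> \<open>\<open>c\<close> is the product of the normalising denominator of
    \<open>lag n i\<close> and the conjugate of that of \<open>lag n j\<close>.\<close>
  define c where "c = cinner f (e i) * cnj (cinner f (e j)) * complex_of_real (?q i i * ?q j j)"
  have c: "c \<noteq> 0" using node_poly_nz f_nz by (simp add: c_def)
  let ?t = "\<lambda>s. (P_poly lam n (lam s))\<^sup>2 * (cmod (cinner f (e s)))\<^sup>2 /
    ((lam s - lam i) * (lam s - lam j))"
  have outside: "{s. \<bar>s\<bar> > int n} = UNIV - ?I" by auto
  have t: "complex_of_real (?t s) = c * ?g s" if "s \<in> UNIV - ?I" for s
  proof -
    have "lam s \<noteq> lam i" "lam s \<noteq> lam j"
      using inj_lam that i j by (auto simp: inj_eq)
    then have "?t s = (P_poly lam n (lam s) / (lam s - lam i)) *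
        (P_poly lam n (lam s) / (lam s - lam j)) * (cmod (cinner f (e s)))\<^sup>2"
      by (simp add: power2_eq_square)
    also have "P_poly lam n (lam s) / (lam s - lam i) = ?q i s"
      using P_poly_eq[OF i, of "lam s"] \<open>lam s \<noteq> lam i\<close> by simp
    also have "P_poly lam n (lam s) / (lam s - lam j) = ?q j s"
      using P_poly_eq[OF j, of "lam s"] \<open>lam s \<noteq> lam j\<close> by simp
    finally have "?t s = ?q i s * ?q j s * (cmod (cinner f (e s)))\<^sup>2" .
    then show ?thesis
      using node_poly_nz f_nz complex_norm_square[of "cinner f (e s)"]
      by (simp add: coord_lag c_def field_simps)
  qed
  have "(\<Sum>s\<in>?I. ?g s) = (\<Sum>s\<in>?I. if s = i then (if i = j then 1 else 0) else 0)"
    by (rule sum.cong) (auto simp: coord_lag_node)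
  also have "\<dots> = (if i = j then 1 else 0)" using i by simp
  finally have "(?g has_sum (if i = j then 1 else 0)) ?I"
    using has_sum_finite[of ?I ?g] by simp
  \<comment> \<open>Removing the finite block of nodes, which contributes the Kronecker delta, from
    Parseval's sum leaves exactly the tail that occurs in \<open>K_entry\<close>.\<close>
  then have "(?g has_sum (cinner (lag n i) (lag n j) - (if i = j then 1 else 0))) (UNIV - ?I)"
    by (intro has_sum_Diff Parseval[OF basis]) auto
  from has_sum_cmult_right[OF this, of c]
  have "((\<lambda>s. complex_of_real (?t s)) has_sum
      c * (cinner (lag n i) (lag n j) - (if i = j then 1 else 0))) (UNIV - ?I)"
    by (rule has_sum_cong[THEN iffD1, rotated]) (simp only: t)
  then have "complex_of_real (\<Sum>\<^sub>\<infinity>s\<in>UNIV - ?I. ?t s) =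
      c * (cinner (lag n i) (lag n j) - (if i = j then 1 else 0))"
    by (rule of_real_infsum_eq)
  then have "K_entry lam e f n i j = cinner (lag n i) (lag n j) - (if i = j then 1 else 0)"
    unfolding K_entry_def outside deriv_P_poly[OF i] deriv_P_poly[OF j]
    using c by (simp only: of_real_mult) (simp add: c_def field_simps)
  then show ?thesis by simp
qed

text \<open>Each \<open>node_poly n i\<close> has degree \<open>2 * n\<close>, which gives one
  inclusion. For the other, interpolation at \<open>2 * n + 1\<close> nodes reproduces every
  monomial of degree at most \<open>2 * n\<close>.\<close>

lemma cspan_lag: "cspan (lag n ` {- int n..int n}) = cspan (b ` {..2 * n})"
proof (rule complex_vector.span_eq[THEN iffD2], intro conjI subsetI)
  fix x
  assume "x \<in> lag n ` {- int n..int n}"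
  then obtain i where i: "i \<in> {- int n..int n}" "x = lag n i" by auto
  then show "x \<in> cspan (b ` {..2 * n})"
    unfolding i(2) lag_def poly_vec_def degree_node_poly[OF i(1)]
    by (intro complex_vector.span_scale complex_vector.span_sum complex_vector.span_base) auto
next
  fix x
  assume "x \<in> b ` {..2 * n}"
  then obtain m where m: "m \<le> 2 * n" "x = b m" by auto
  let ?I = "{- int n..int n}"
  let ?q = "node_poly n"
  let ?L = "\<Sum>i\<in>?I. smult (lam i ^ m / poly (?q i) (lam i)) (?q i)"
  have Lagrange: "monom 1 m = ?L"
  proof (rule poly_eqI_degree)
    show "poly (monom 1 m) y = poly ?L y" if y: "y \<in> lam ` ?I" for y
    proof -
      obtain s where s: "s \<in> ?I" "y = lam s" using y by auto
      have "poly ?L y = (\<Sum>i\<in>?I. if i = s then lam s ^ m else 0)"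
        unfolding s(2) poly_sum poly_smult
        using node_poly_eq_0[OF s(1)] node_poly_nz by (intro sum.cong) auto
      then show ?thesis using s by (simp add: poly_monom)
    qed
    have card: "card (lam ` ?I) = 2 * n + 1"
      using inj_on_subset[OF inj_lam] by (simp add: card_image)
    then show "degree (monom (1 :: real) m) < card (lam ` ?I)"
      using m by (simp add: degree_monom_eq)
    have "degree ?L \<le> 2 * n"
      by (rule degree_sum_le) (auto simp: degree_node_poly intro: order_trans[OF degree_smult_le])
    with card show "degree ?L < card (lam ` ?I)" by simp
  qed
  \<comment> \<open>The coefficient of \<open>lag n i\<close> is the \<open>i\<close>-th coordinate
    of \<open>b m\<close>, as the coordinates of the Lagrange vectors at the nodes are Kronecker
    deltas.\<close>
  have "x = (\<Sum>i\<in>?I. (complex_of_real (lam i ^ m) * cinner f (e i)) *\<^sub>C lag n i)"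
  proof (rule orthonormal_coords_eqI[OF basis])
    fix s
    have "lam s ^ m = (\<Sum>i\<in>?I. lam i ^ m / poly (?q i) (lam i) * poly (?q i) (lam s))"
      using arg_cong[OF Lagrange, of "\<lambda>p. poly p (lam s)"] by (simp add: poly_monom poly_sum)
    then have "cinner x (e s) = complex_of_real
        (\<Sum>i\<in>?I. lam i ^ m / poly (?q i) (lam i) * poly (?q i) (lam s)) * cinner f (e s)"
      by (simp add: m(2) coord)
    also have "\<dots> = cinner (\<Sum>i\<in>?I. (complex_of_real (lam i ^ m) * cinner f (e i)) *\<^sub>C lag n i) (e s)"
      unfolding cinner_sum_left cinner_scaleC_left coord_lag of_real_sum sum_distrib_right
      using f_nz by (intro sum.cong) auto
    finally show "cinner x (e s) = \<dots>" .
  qed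
  moreover have "\<dots> \<in> cspan (lag n ` ?I)"
    by (intro complex_vector.span_sum complex_vector.span_scale complex_vector.span_base) auto
  ultimately show "x \<in> cspan (lag n ` ?I)" by simp
qed

section \<open>The resolvent entry as a squared distance\<close>

definition "Gram n = 1\<^sub>m (2 * n + 1) + K_matrix lam e f n"

lemma Gram_eq:
  "Gram n = mat (2 * n + 1) (2 * n + 1)
     (\<lambda>(a, c). cinner (lag n (int a - int n)) (lag n (int c - int n)))"
  unfolding Gram_def by (rule eq_matI) (auto simp: K_matrix_def Gram_lag)

text \<open>The entries of \<open>x\<close> appear conjugated because \<open>cinner\<close> is
  conjugate-linear in its second argument.\<close>

lemma Gram_mult_vec:
  assumes x: "x \<in> carrier_vec (2 * n + 1)" and a: "a < 2 * n + 1"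
  shows "(Gram n *\<^sub>v x) $ a = cinner (lag n (int a - int n))
     (\<Sum>c<2 * n + 1. cnj (x $ c) *\<^sub>C lag n (int c - int n))"
  using assms unfolding Gram_eq
  by (simp add: scalar_prod_def cinner_sum_right cinner_scaleC_right lessThan_atLeast0 mult.commute del: sum.op_ivl_Suc)

lemma coord_lag_sum:
  assumes "c < 2 * n + 1"
  shows "cinner (\<Sum>a<2 * n + 1. z a *\<^sub>C lag n (int a - int n)) (e (int c - int n)) = z c"
proof -
  have "cinner (\<Sum>a<2 * n + 1. z a *\<^sub>C lag n (int a - int n)) (e (int c - int n)) =
      (\<Sum>a<2 * n + 1. if a = c then z c else 0)"
    unfolding cinner_sum_left cinner_scaleC_left
    using assms by (intro sum.cong) (auto simp: coord_lag_node)
  then show ?thesis using assms by simp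
qed

text \<open>A kernel vector gives a combination \<open>v\<close> of Lagrange vectors orthogonal to
  all of them, hence to itself. Then \<open>v = 0\<close>, and its coordinates at the nodes show
  that the kernel vector vanishes. Thus \<open>the (mat_inverse (Gram n))\<close> is a genuine
  inverse.\<close>

lemma Gram_invertible: "\<exists>B. mat_inverse (Gram n) = Some B \<and> B \<in> carrier_mat (2 * n + 1) (2 * n + 1)
    \<and> Gram n * B = 1\<^sub>m (2 * n + 1)"
proof -
  let ?N = "2 * n + 1"
  have G: "Gram n \<in> carrier_mat ?N ?N" by (simp add: Gram_def K_matrix_def)
  have "det (Gram n) \<noteq> 0"
  proof
    assume "det (Gram n) = 0"
    then obtain x where x: "x \<in> carrier_vec ?N" "x \<noteq> 0\<^sub>v ?N" "Gram n *\<^sub>v x = 0\<^sub>v ?N"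
      using det_0_iff_vec_prod_zero_field[OF G] by auto
    define v where "v = (\<Sum>c<?N. cnj (x $ c) *\<^sub>C lag n (int c - int n))"
    have "cinner (lag n (int a - int n)) v = 0" if "a < ?N" for a
      using Gram_mult_vec[OF x(1) that] x(3) that by (simp add: v_def)
    then have "cinner v v = 0"
      by (subst v_def) (simp add: cinner_sum_left cinner_scaleC_left del: sum.lessThan_Suc)
    then have "v = 0" by (simp add: cinner_self)
    then have "x $ c = 0" if "c < ?N" for c
      using coord_lag_sum[OF that, of "\<lambda>c. cnj (x $ c)"] by (simp add: v_def cinner_zero_left)
    then have "x = 0\<^sub>v ?N" using x(1) by (intro eq_vecI) auto
    with x(2) show False by simp
  qed
  from det_non_zero_imp_unit[OF G this, of "()"] show ?thesis
    using mat_inverse(1)[OF G, of "()"] mat_inverse(2)[OF G] by (cases "mat_inverse (Gram n)") auto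
qed

text \<open>If \<open>Gram n *\<^sub>v x = delta_vec n k\<close>, then \<open>\<Sum>\<^sub>i cnj x\<^sub>i lag n i\<close> has the same inner product as
  \<open>e k\<close> with every \<open>lag n i\<close>, so it is the orthogonal projection of \<open>e k\<close>, and its \<open>k\<close>-th
  coordinate \<open>cnj x\<^sub>k\<close> is its squared norm.\<close>

lemma resolvent_entry:
  assumes k: "k \<in> {- int n..int n}"
  obtains v where "v \<in> cspan (b ` {..2 * n})"
    and "\<And>y. y \<in> cspan (b ` {..2 * n}) \<Longrightarrow> norm (e k - v) \<le> norm (e k - y)"
    and "(the (mat_inverse (Gram n)) *\<^sub>v delta_vec n k) \<bullet>c delta_vec n k
       = complex_of_real (1 - (norm (e k - v))\<^sup>2)"
proof -
  let ?N = "2 * n + 1"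
  let ?d = "delta_vec n k"
  let ?B = "lag n ` {- int n..int n}"
  \<comment> \<open>The matrix position, counted from 0, of the index \<open>k\<close>.\<close>
  define kk where "kk = nat (k + int n)"
  have kk: "kk < ?N" "int kk - int n = k" using k by (auto simp: kk_def)
  obtain B where B: "mat_inverse (Gram n) = Some B" "B \<in> carrier_mat ?N ?N" "Gram n * B = 1\<^sub>m ?N"
    using Gram_invertible by auto
  have G: "Gram n \<in> carrier_mat ?N ?N" by (simp add: Gram_def K_matrix_def)
  have d: "?d \<in> carrier_vec ?N" by (simp add: delta_vec_def)
  define x where "x = B *\<^sub>v ?d"
  have x: "x \<in> carrier_vec ?N" using B d by (auto simp: x_def)
  have Gx: "Gram n *\<^sub>v x = ?d"
    unfolding x_def using G B d by (metis assoc_mult_mat_vec one_mult_mat_vec)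
  define v where "v = (\<Sum>c<?N. cnj (x $ c) *\<^sub>C lag n (int c - int n))"
  have vB: "v \<in> cspan ?B"
    unfolding v_def
    by (intro complex_vector.span_sum complex_vector.span_scale complex_vector.span_base) auto
  have orth: "cinner w (e k - v) = 0" if "w \<in> ?B" for w
  proof -
    obtain i where i: "i \<in> {- int n..int n}" "w = lag n i" using \<open>w \<in> ?B\<close> by auto
    define a where "a = nat (i + int n)"
    have a: "a < ?N" "int a - int n = i" using i by (auto simp: a_def)
    have "(Gram n *\<^sub>v x) $ a = cinner (lag n (int a - int n)) v"
      unfolding v_def by (rule Gram_mult_vec[OF x a(1)])
    then have "cinner w v = ?d $ a" by (simp only: Gx a(2) i(2))
    also have "\<dots> = cinner w (e k)"
      using a k by (auto simp: delta_vec_def i(2) coord_lag_node)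
    finally show ?thesis by (simp add: cinner_diff_right)
  qed
  have v_orth: "cinner v (e k - v) = 0" by (rule cinner_cspan_eq_0[OF vB orth])
  from norm_add_orthogonal[OF this] have pyth: "(norm (e k))\<^sup>2 = (norm v)\<^sup>2 + (norm (e k - v))\<^sup>2"
    by simp
  have "cinner (e k) (e k) = 1" using basis by (simp add: orthonormal_basis_def)
  then have "(norm (e k))\<^sup>2 = 1" unfolding cinner_self by (simp only: of_real_eq_1_iff)
  with pyth have nv: "(norm v)\<^sup>2 = 1 - (norm (e k - v))\<^sup>2" by simp
  have "cnj (x $ kk) = cinner v (e k)"
    using coord_lag_sum[OF kk(1), of "\<lambda>c. cnj (x $ c)"] by (simp add: v_def kk(2))
  also have "\<dots> = complex_of_real ((norm v)\<^sup>2)"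
    using v_orth by (simp add: cinner_diff_right cinner_self)
  \<comment> \<open>The conjugation disappears because a squared norm is real.\<close>
  finally have xk: "x $ kk = complex_of_real (1 - (norm (e k - v))\<^sup>2)"
    unfolding nv by (metis complex_cnj_cnj complex_cnj_complex_of_real)
  have "x \<bullet>c ?d = (\<Sum>a<?N. if a = kk then x $ kk else 0)"
    using kk unfolding scalar_prod_def lessThan_atLeast0
    by (intro sum.cong) (auto simp: delta_vec_def)
  also have "\<dots> = x $ kk" using kk(1) by simp
  finally have "(the (mat_inverse (Gram n)) *\<^sub>v ?d) \<bullet>c ?d = complex_of_real (1 - (norm (e k - v))\<^sup>2)"
    by (simp add: B(1) x_def[symmetric] xk)
  moreover have "norm (e k - v) \<le> norm (e k - y)" if "y \<in> cspan (b ` {..2 * n})" for y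
    using orthogonal_projection_nearest[OF vB _ orth] that by (simp add: cspan_lag)
  ultimately show ?thesis using that vB by (simp add: cspan_lag)
qed

text \<open>The spans of \<open>b 0\<close>, ..., \<open>b (2 * n)\<close> increase and exhaust
  \<open>cspan (range b)\<close>. Hence the distances from \<open>e k\<close> to them tend to 0
  exactly when \<open>e k\<close> lies in the closure.\<close>

lemma mem_closure_iff_resolvent_limit:
  "e k \<in> closure (cspan (range b)) \<longleftrightarrow>
    (\<lambda>n. (the (mat_inverse (Gram n)) *\<^sub>v delta_vec n k) \<bullet>c delta_vec n k) \<longlonglongrightarrow> 1"
  (is "?L \<longleftrightarrow> ?r \<longlonglongrightarrow> 1")
proof
  assume ?L
  show "?r \<longlonglongrightarrow> 1"
  proof (rule LIMSEQ_I)
    fix \<epsilon> :: real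
    assume "\<epsilon> > 0"
    \<comment> \<open>The square root enters because the entry differs from 1 by the squared
      distance.\<close>
    then obtain y where y: "y \<in> cspan (range b)" "dist y (e k) < sqrt \<epsilon>"
      using closure_approachable[THEN iffD1, OF \<open>?L\<close>, rule_format, of "sqrt \<epsilon>"] by auto
    obtain F where F: "finite F" "y \<in> cspan (b ` F)"
      using cspan_subset_eq_finite_image[OF y(1)] .
    obtain M where M: "F \<subseteq> {..M}" using F(1) finite_nat_iff_bounded_le by auto
    \<comment> \<open>The bound \<open>nat \<bar>k\<bar>\<close> makes \<open>k\<close> one of the
      indices of order \<open>n\<close>; \<open>M\<close> ensures that the \<open>n\<close>-th span
      contains \<open>y\<close>.\<close>
    have "norm (?r n - 1) < \<epsilon>" if n: "n \<ge> max M (nat \<bar>k\<bar>)" for n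
    proof -
      have "k \<in> {- int n..int n}" using n by auto
      then obtain v where v: "\<And>y. y \<in> cspan (b ` {..2 * n}) \<Longrightarrow> norm (e k - v) \<le> norm (e k - y)"
        "?r n = complex_of_real (1 - (norm (e k - v))\<^sup>2)"
        using resolvent_entry by metis
      have "F \<subseteq> {..2 * n}" using M n by fastforce
      then have "y \<in> cspan (b ` {..2 * n})"
        using F(2) complex_vector.span_mono[OF image_mono] by blast
      then have "norm (e k - v) < sqrt \<epsilon>"
        using v(1) y(2) by (fastforce simp: dist_norm norm_minus_commute)
      then have "(norm (e k - v))\<^sup>2 < (sqrt \<epsilon>)\<^sup>2" by (intro power_strict_mono) auto
      then show ?thesis using \<open>\<epsilon> > 0\<close> by (simp add: v(2) norm_power)
    qed
    then show "\<exists>N. \<forall>n\<ge>N. norm (?r n - 1) < \<epsilon>" by blast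
  qed
next
  assume lim: "?r \<longlonglongrightarrow> 1"
  show ?L
    unfolding closure_approachable
  proof (intro allI impI)
    fix \<epsilon> :: real
    assume \<epsilon>: "\<epsilon> > 0"
    then obtain N where N: "\<forall>n\<ge>N. norm (?r n - 1) < \<epsilon>\<^sup>2"
      using LIMSEQ_D[OF lim, of "\<epsilon>\<^sup>2"] by auto
    define n where "n = max N (nat \<bar>k\<bar>)"
    have "k \<in> {- int n..int n}" by (auto simp: n_def)
    then obtain v where v: "v \<in> cspan (b ` {..2 * n})"
      "?r n = complex_of_real (1 - (norm (e k - v))\<^sup>2)"
      using resolvent_entry by metis
    have "norm (?r n - 1) < \<epsilon>\<^sup>2" using N by (simp add: n_def)
    then have "(norm (e k - v))\<^sup>2 < \<epsilon>\<^sup>2" by (simp add: v(2) norm_power)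
    then have "norm (e k - v) < \<epsilon>" by (rule power2_less_imp_less) (use \<epsilon> in simp)
    moreover have "v \<in> cspan (range b)"
      using v(1) complex_vector.span_mono[of "b ` {..2 * n}" "range b"] by auto
    ultimately show "\<exists>y\<in>cspan (range b). dist y (e k) < \<epsilon>"
      by (auto simp: dist_norm norm_minus_commute)
  qed
qed

end

section \<open>Cyclicity tested on the basis vectors\<close>

lemma orthonormal_basis_dense_iff:
  assumes "orthonormal_basis e" and "csubspace S"
  shows "closure S = UNIV \<longleftrightarrow> (\<forall>k. e k \<in> closure S)"
proof
  assume "\<forall>k. e k \<in> closure S"
  \<comment> \<open>The closure of \<open>S\<close> is a closed subspace, so it absorbs first the
    span of the basis and then the closure of that span.\<close>
  then have "cspan (range e) \<subseteq> closure S"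
    by (intro complex_vector.span_minimal closure_csubspace assms(2)) auto
  then have "closure (cspan (range e)) \<subseteq> closure S" by (simp add: closure_minimal)
  with assms(1) show "closure S = UNIV" by (auto simp: orthonormal_basis_def)
qed simp

theorem theorem1:
  fixes D :: "'a::complex_hilbert set" and A :: "'a \<Rightarrow> 'a"
    and lam :: "int \<Rightarrow> real" and e :: "int \<Rightarrow> 'a" and f :: 'a
  assumes "separable_space (euclidean :: 'a topology)"
    and "self_adjoint D A"
    and "\<forall>j. lam j < lam (j + 1)"
    and "simple_point_spectrum D A lam"
    and "orthonormal_basis e"
    and "\<forall>j. e j \<in> D \<and> A (e j) = complex_of_real (lam j) *\<^sub>C e j"
    and "f \<in> C_infinity D A"
  shows "cyclic_vector D A f \<longleftrightarrow>
    (\<forall>k::int. cinner f (e k) \<noteq> 0 \<and>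
      (\<lambda>n. (the (mat_inverse (1\<^sub>m (2 * n + 1) + K_matrix lam e f n)) *\<^sub>v delta_vec n k) \<bullet>c delta_vec n k)
        \<longlonglongrightarrow> 1)"
proof -
  let ?b = "\<lambda>m. (A ^^ m) f"
  have coord: "cinner (?b m) (e s) = complex_of_real (lam s ^ m) * cinner f (e s)" for m s
    using cinner_power_eigenvector[OF assms(2,7)] assms(6) by blast
  have less: "lam i < lam (i + int d + 1)" for i d
  proof (induction d)
    case (Suc d)
    have "lam (i + int d + 1) < lam (i + int d + 1 + 1)" using assms(3) by blast
    with Suc show ?case by (simp add: add.commute add.left_commute)
  qed (use assms(3) in simp)
  have "strict_mono lam"
  proof (rule strict_monoI)
    show "lam i < lam j" if "i < j" for i j
      \<comment> \<open>The fact \<open>less\<close> at \<open>d\<close> covers the gap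
        \<open>d + 1\<close>, hence the subtraction of 1.\<close>
      using less[of i "nat (j - i - 1)"] that by simp
  qed
  then have "inj lam" by (rule strict_mono_imp_inj_on)
  have cyclic_iff: "cyclic_vector D A f \<longleftrightarrow> (\<forall>k. e k \<in> closure (cspan (range ?b)))"
    using orthonormal_basis_dense_iff[OF assms(5) complex_vector.subspace_span] assms(7)
    by (simp add: cyclic_vector_def)
  \<comment> \<open>A vanishing coordinate would make \<open>e k\<close> orthogonal to every
    \<open>?b m\<close>, hence to a dense subspace.\<close>
  have nz: "cinner f (e k) \<noteq> 0" if "cyclic_vector D A f" for k
  proof
    assume 0: "cinner f (e k) = 0"
    have dense: "closure (cspan (range ?b)) = UNIV" using that by (simp add: cyclic_vector_def)
    have "cinner (?b m) (e k) = 0" for m unfolding coord 0 by simp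
    then have "cinner y (e k) = 0" if "y \<in> cspan (range ?b)" for y
      using cinner_cspan_eq_0[OF that] by blast
    then have "e k = 0" by (rule eq_0_if_orthogonal_to_dense[OF dense])
    moreover have "cinner (e k) (e k) = 1" using assms(5) by (simp add: orthonormal_basis_def)
    ultimately show False by (simp add: cinner_zero_left)
  qed
  show ?thesis
  proof (cases "\<forall>k. cinner f (e k) \<noteq> 0")
    case True
    then interpret moment_sequence e lam f ?b
      using assms(5) \<open>inj lam\<close> coord by unfold_locales auto
    show ?thesis
      unfolding cyclic_iff mem_closure_iff_resolvent_limit Gram_def using True by simp
  next
    \<comment> \<open>Both sides are false: the left by \<open>nz\<close>, the right by its first
      condition.\<close>
    case False
    then show ?thesis using nz by blast
  qed
qed

end
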